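(* Let $W$ be an ultrafilter on a regular cardinal $\kappa$. If $\diamondsuit^*_{\mathrm{thin}}(W)$ holds, then $W$ is non-Galvin.
   Context: All ultrafilters are $\sigma$-complete. A function $f$ on $\kappa$ is almost one-to-one mod $W$ if there is $A\in W$ such that $\{\alpha\in A\mid f(\alpha)=x\}$ is bounded below $\kappa$ for every $x$. $\diamondsuit^*_{\mathrm{thin}}(W)$ is the statement that there is a sequence of sets $\langle\mathcal A_\alpha\rangle_{\alpha<\kappa}$ such that: (1) for all $A\subseteq\kappa$, for $W$-almost all $\alpha$, $A\cap\alpha\in\mathcal A_\alpha$ (i.e. $\{\alpha<\kappa\mid A\cap\alpha\in\mathcal A_\alpha\}\in W$); (2) the function $\alpha\mapsto|\mathcal A_\alpha|$ is not almost one-to-one mod $W$. A uniform ultrafilter $W$ over $\kappa$ has the Galvin property if for every sequence $\langle A_i\rangle_{i<2^\kappa}$ of members of $W$ there is $I\subseteq2^\kappa$ with $|I|=\kappa$ and $\bigcap_{i\in I}A_i\in W$; $W$ is non-Galvin if it does not have the Galvin property.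
   Formalization: The thin diamond principle also requires |A_α|^+ < κ for all α (for limit κ: |A_α| < κ; for κ = λ^+: |A_α| < λ); without a bound, A_α = P(κ) satisfies it for every uniform W, including normal ultrafilters on a measurable cardinal, which are Galvin. *)

theory Defs
  imports Main
begin

unbundle cardinal_syntax

text \<open>
  A cardinal \<open>\<kappa>\<close> is a relation with \<^term>\<open>Card_order \<kappa>\<close>. The elements of
  \<^term>\<open>Field \<kappa>\<close> play the role of the ordinals below \<open>\<kappa>\<close>, and the set \<open>\<alpha>\<close> of
  predecessors of \<open>\<alpha>\<close> is \<^term>\<open>underS \<kappa> \<alpha>\<close>.
\<close>

definition regular_cardinal :: "'a rel \<Rightarrow> bool" where
  "regular_cardinal \<kappa> \<longleftrightarrow> Card_order \<kappa> \<and> infinite (Field \<kappa>) \<and> regularCard \<kappa>"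

definition ultrafilter_on :: "'a set \<Rightarrow> 'a set set \<Rightarrow> bool" where
  "ultrafilter_on X W \<longleftrightarrow>
     W \<subseteq> Pow X \<and> X \<in> W \<and> {} \<notin> W \<and>
     (\<forall>A\<in>W. \<forall>B\<in>W. A \<inter> B \<in> W) \<and>
     (\<forall>A\<in>W. \<forall>B. A \<subseteq> B \<and> B \<subseteq> X \<longrightarrow> B \<in> W) \<and>
     (\<forall>A. A \<subseteq> X \<longrightarrow> A \<in> W \<or> X - A \<in> W)"

definition sigma_complete :: "'a set set \<Rightarrow> bool" where
  "sigma_complete W \<longleftrightarrow>
     (\<forall>A :: nat \<Rightarrow> 'a set. (\<forall>n. A n \<in> W) \<longrightarrow> (\<Inter>n. A n) \<in> W)"

definition uniform :: "'a rel \<Rightarrow> 'a set set \<Rightarrow> bool" where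
  "uniform \<kappa> W \<longleftrightarrow> (\<forall>A\<in>W. |A| =o \<kappa>)"

definition bounded_below :: "'a rel \<Rightarrow> 'a set \<Rightarrow> bool" where
  "bounded_below \<kappa> S \<longleftrightarrow> (\<exists>\<beta>\<in>Field \<kappa>. \<forall>\<alpha>\<in>S. (\<alpha>, \<beta>) \<in> \<kappa>)"

definition almost_one_to_one :: "'a rel \<Rightarrow> 'a set set \<Rightarrow> ('a \<Rightarrow> 'b) \<Rightarrow> bool" where
  "almost_one_to_one \<kappa> W f \<longleftrightarrow>
     (\<exists>A\<in>W. \<forall>x. bounded_below \<kappa> {\<alpha> \<in> A. f \<alpha> = x})"

text \<open>
  The cardinality of a set as a value that can be compared by \<open>=\<close>: its equipotence
  class. (The relation \<open>|S|\<close> will not do, since equipotent sets have different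
  \<open>|S|\<close>; the library's \<open>card\<close> is \<open>0\<close> on all infinite sets.)
\<close>

definition cardinality :: "'b set \<Rightarrow> 'b set set" where
  "cardinality S = {T. |T| =o |S|}"

text \<open>
  The first conjunct is the smallness requirement on the \<open>\<A> \<alpha>\<close>: their
  cardinalities, and the successors of these, are below \<open>\<kappa>\<close>. For a limit cardinal
  \<open>\<kappa>\<close> this says just \<open>|\<A> \<alpha>| < \<kappa>\<close>, i.e. \<open>\<alpha> \<mapsto> |\<A> \<alpha>|\<close> is a function from \<open>\<kappa>\<close> to
  \<open>\<kappa>\<close>; for \<open>\<kappa> = \<lambda>\<^sup>+\<close> it says \<open>|\<A> \<alpha>| < \<lambda>\<close>. Without any bound the constant sequence
  \<open>\<A> \<alpha> = Pow (Field \<kappa>)\<close> would be a witness for every uniform ultrafilter, including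
  the normal ones on a measurable cardinal, which have the Galvin property. With the
  bound \<open>|\<A> \<alpha>| \<le> \<lambda>\<close> for \<open>\<kappa> = \<lambda>\<^sup>+\<close>, the last conjunct would hold automatically for every
  uniform ultrafilter (fewer than \<open>\<kappa>\<close> values on an unbounded set) and would not
  express thinness.
\<close>

definition diamond_star_thin :: "'a rel \<Rightarrow> 'a set set \<Rightarrow> bool" where
  "diamond_star_thin \<kappa> W \<longleftrightarrow>
     (\<exists>\<A> :: 'a \<Rightarrow> 'a set set.
        (\<forall>\<alpha>\<in>Field \<kappa>. cardSuc |\<A> \<alpha>| <o \<kappa>) \<and>
        (\<forall>A. A \<subseteq> Field \<kappa> \<longrightarrow> {\<alpha> \<in> Field \<kappa>. A \<inter> underS \<kappa> \<alpha> \<in> \<A> \<alpha>} \<in> W) \<and>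
        \<not> almost_one_to_one \<kappa> W (\<lambda>\<alpha>. cardinality (\<A> \<alpha>)))"

text \<open>
  Sequences of length \<open>2\<^sup>\<kappa>\<close> are indexed by the field of the cardinal \<open>2\<^sup>\<kappa>\<close>; only the
  cardinality of the index set matters.
\<close>

definition galvin_property :: "'a rel \<Rightarrow> 'a set set \<Rightarrow> bool" where
  "galvin_property \<kappa> W \<longleftrightarrow>
     (\<forall>A :: ('a \<Rightarrow> bool) \<Rightarrow> 'a set.
        (\<forall>i\<in>Field (BNF_Cardinal_Arithmetic.ctwo ^c \<kappa>). A i \<in> W) \<longrightarrow>
        (\<exists>I. I \<subseteq> Field (BNF_Cardinal_Arithmetic.ctwo ^c \<kappa>) \<and> |I| =o \<kappa> \<and>
             (\<Inter>i\<in>I. A i) \<in> W))"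

text \<open>
  The Galvin property is only considered for uniform ultrafilters, so being
  non-Galvin includes being uniform.
\<close>

definition non_galvin :: "'a rel \<Rightarrow> 'a set set \<Rightarrow> bool" where
  "non_galvin \<kappa> W \<longleftrightarrow> uniform \<kappa> W \<and> \<not> galvin_property \<kappa> W"

end

theory Submission
  imports Defs
begin

text \<open>
  Guess every \<open>A \<subseteq> \<kappa>\<close>: the \<open>2\<^sup>\<kappa>\<close> sets \<open>B\<^sub>A = {\<alpha>. A \<inter> \<alpha> \<in> \<A>\<^sub>\<alpha>}\<close> lie in \<open>W\<close>. If \<open>B \<in> W\<close> were
  contained in \<open>\<kappa>\<close> many of them, thinness would give a cardinal \<open>\<lambda>\<close> with \<open>|\<A>\<^sub>\<alpha>| = \<lambda>\<close> for
  unboundedly many \<open>\<alpha> \<in> B\<close>. But \<open>\<lambda>\<^sup>+ < \<kappa>\<close> many of the guessed sets are, by regularity,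
  separated below some \<open>\<beta> < \<kappa>\<close>, and their traces on such an \<open>\<alpha> > \<beta>\<close> are \<open>\<lambda>\<^sup>+\<close> distinct
  members of \<open>\<A>\<^sub>\<alpha>\<close>. Uniformity is immediate: every function is almost one-to-one on a bounded
  member of \<open>W\<close>.
\<close>

lemma Well_order_in_or_underS:
  assumes "Well_order r" and "a \<in> Field r" and "b \<in> Field r"
  shows "(a, b) \<in> r \<or> b \<in> underS r a"
proof -
  have "(b, b) \<in> r"
    using assms by (auto simp: order_on_defs refl_on_def)
  moreover have "Total r" using assms(1) by (simp add: order_on_defs)
  then have "a \<noteq> b \<Longrightarrow> (a, b) \<in> r \<or> (b, a) \<in> r"
    using assms(2,3) by (simp add: total_on_def)
  ultimately show ?thesis by (cases "a = b") (auto simp: underS_def)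
qed

text \<open>Regularity keeps \<open>D\<close> from being cofinal. As \<open>cofinal\<close> asks for
  strictly larger elements, its failure yields a weak upper bound, which is the form
  \<open>bounded_below\<close> wants.\<close>

lemma regular_cardinal_bounded_below:
  assumes "regular_cardinal \<kappa>" and "D \<subseteq> Field \<kappa>" and "|D| <o \<kappa>"
  shows "bounded_below \<kappa> D"
proof -
  have "\<not> cofinal D \<kappa>"
    using assms not_ordLess_ordIso unfolding regular_cardinal_def regularCard_def by blast
  then obtain \<beta> where \<beta>: "\<beta> \<in> Field \<kappa>" "\<And>d. d \<in> D \<Longrightarrow> \<beta> = d \<or> (\<beta>, d) \<notin> \<kappa>"
    unfolding cofinal_def by blast
  have wo: "Well_order \<kappa>"
    using assms(1) unfolding regular_cardinal_def card_order_on_def by blast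
  have "(d, \<beta>) \<in> \<kappa>" if "d \<in> D" for d
    using Well_order_in_or_underS[OF wo, of d \<beta>] \<beta>(1) \<beta>(2)[OF that] assms(2) that
    by (auto simp: underS_def)
  with \<beta>(1) show ?thesis unfolding bounded_below_def by blast
qed

lemma not_bounded_below_obtain:
  assumes "Well_order \<kappa>" and "S \<subseteq> Field \<kappa>" and "\<not> bounded_below \<kappa> S" and "\<beta> \<in> Field \<kappa>"
  obtains \<alpha> where "\<alpha> \<in> S" and "\<beta> \<in> underS \<kappa> \<alpha>"
proof -
  from assms(3,4) obtain \<alpha> where \<alpha>: "\<alpha> \<in> S" "(\<alpha>, \<beta>) \<notin> \<kappa>"
    unfolding bounded_below_def by blast
  then have "\<beta> \<in> underS \<kappa> \<alpha>"
    using Well_order_in_or_underS[OF assms(1), of \<alpha> \<beta>] assms(2,4) by auto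
  with \<alpha>(1) show thesis by (rule that)
qed

text \<open>Choose a point of difference for each pair of distinct indices. There are fewer than
  \<kappa> pairs, so regularity bounds these points by one \<beta>, and every initial segment
  containing \<beta> contains them all.\<close>

lemma inj_on_traces:
  assumes reg: "regular_cardinal \<kappa>" and K: "|K| <o \<kappa>"
    and inj: "inj_on F K" and F: "F ` K \<subseteq> Pow (Field \<kappa>)"
  obtains \<beta> where "\<beta> \<in> Field \<kappa>"
    and "\<And>\<alpha>. \<beta> \<in> underS \<kappa> \<alpha> \<Longrightarrow> inj_on (\<lambda>k. F k \<inter> underS \<kappa> \<alpha>) K"
proof -
  have co: "Card_order \<kappa>" and inf: "infinite (Field \<kappa>)"
    using reg unfolding regular_cardinal_def by auto
  have wo: "Well_order \<kappa>" using co unfolding card_order_on_def by blast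
  then have tr: "trans \<kappa>" and an: "antisym \<kappa>"
    by (simp_all add: order_on_defs)
  define P where "P = {(k, l) \<in> K \<times> K. k \<noteq> l}"
  have "\<exists>d. d \<in> Field \<kappa> \<and> (d \<in> F (fst p)) \<noteq> (d \<in> F (snd p))" if "p \<in> P" for p
  proof -
    from that obtain k l where p: "p = (k, l)" "k \<in> K" "l \<in> K" "k \<noteq> l"
      unfolding P_def by blast
    have "F k \<noteq> F l" using inj_onD[OF inj _ p(2,3)] p(4) by blast
    moreover have "F k \<subseteq> Field \<kappa>" "F l \<subseteq> Field \<kappa>"
      using F p(2,3) by blast+
    ultimately obtain d where "d \<in> Field \<kappa>" "(d \<in> F k) \<noteq> (d \<in> F l)" by blast
    then show ?thesis using p(1) by auto
  qed
  then obtain \<delta> where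
    \<delta>: "\<And>p. p \<in> P \<Longrightarrow> \<delta> p \<in> Field \<kappa> \<and> (\<delta> p \<in> F (fst p)) \<noteq> (\<delta> p \<in> F (snd p))"
    by metis
  have "|P| \<le>o |K \<times> K|" by (rule card_of_mono1) (auto simp: P_def)
  then have "|\<delta> ` P| \<le>o |K \<times> K|" by (rule ordLeq_transitive[OF card_of_image])
  moreover have "|K \<times> K| <o \<kappa>"
  proof (cases "finite K")
    case True
    then have "finite (Field |K \<times> K| )" by (simp add: Field_card_of)
    then show ?thesis by (rule finite_ordLess_infinite[OF card_of_Well_order wo _ inf])
  next
    case False
    from ordIso_ordLess_trans[OF card_of_Times_same_infinite[OF False] K] show ?thesis .
  qed
  ultimately have "|\<delta> ` P| <o \<kappa>" by (rule ordLeq_ordLess_trans)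
  then have "bounded_below \<kappa> (\<delta> ` P)"
    using \<delta> by (intro regular_cardinal_bounded_below[OF reg]) auto
  then obtain \<beta> where \<beta>: "\<beta> \<in> Field \<kappa>" "\<And>p. p \<in> P \<Longrightarrow> (\<delta> p, \<beta>) \<in> \<kappa>"
    unfolding bounded_below_def by blast
  show thesis
  proof (rule that[OF \<beta>(1)], rule inj_onI, rule ccontr)
    fix \<alpha> k l
    assume \<alpha>: "\<beta> \<in> underS \<kappa> \<alpha>" and kl: "k \<in> K" "l \<in> K" "k \<noteq> l"
      and eq: "F k \<inter> underS \<kappa> \<alpha> = F l \<inter> underS \<kappa> \<alpha>"
    have p: "(k, l) \<in> P" using kl unfolding P_def by blast
    \<comment> \<open>The bound by \<beta> is only weak, but \<beta> is strictly below \<alpha>;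
      antisymmetry excludes \<open>\<delta> (k, l) = \<alpha>\<close>.\<close>
    have "\<delta> (k, l) \<in> underS \<kappa> \<alpha>"
      using \<beta>(2)[OF p] \<alpha> tr an unfolding underS_def by (auto dest: transD antisymD)
    with \<delta>[OF p] eq show False by auto
  qed
qed

text \<open>Supplies the uniformity conjunct of \<open>non_galvin\<close>: a member of
  \<open>W\<close> of size below \<kappa> is bounded by regularity, and with it all fibres of
  \<open>f\<close> on it.\<close>

lemma not_almost_one_to_one_uniform:
  assumes reg: "regular_cardinal \<kappa>" and W: "W \<subseteq> Pow (Field \<kappa>)"
    and thin: "\<not> almost_one_to_one \<kappa> W f"
  shows "uniform \<kappa> W"
  unfolding uniform_def
proof (intro ballI)
  fix A assume A: "A \<in> W"
  then have sub: "A \<subseteq> Field \<kappa>" using W by blast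
  have co: "Card_order \<kappa>" using reg unfolding regular_cardinal_def by blast
  have "|A| \<le>o \<kappa>"
    using ordLeq_ordIso_trans[OF card_of_mono1[OF sub] card_of_Field_ordIso[OF co]] .
  moreover have "\<not> |A| <o \<kappa>"
  proof
    assume "|A| <o \<kappa>"
    then have "bounded_below \<kappa> A" by (rule regular_cardinal_bounded_below[OF reg sub])
    then have "almost_one_to_one \<kappa> W f"
      using A unfolding almost_one_to_one_def bounded_below_def by blast
    with thin show False ..
  qed
  ultimately show "|A| =o \<kappa>" using ordLeq_iff_ordLess_or_ordIso by blast
qed

text \<open>Elements of the exponential all take the value \<open>undefined\<close> off
  \<open>Field \<kappa>\<close>, so an index is determined by the subset of \<kappa> that it
  codes.\<close>

lemma inj_on_Collect_Field_cexp:
  "inj_on (\<lambda>i. {\<xi> \<in> Field \<kappa>. i \<xi>}) (Field (BNF_Cardinal_Arithmetic.ctwo ^c \<kappa>))"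
proof (intro inj_onI ext)
  fix i j \<xi>
  assume "i \<in> Field (BNF_Cardinal_Arithmetic.ctwo ^c \<kappa>)"
    and "j \<in> Field (BNF_Cardinal_Arithmetic.ctwo ^c \<kappa>)"
    and eq: "{\<xi> \<in> Field \<kappa>. i \<xi>} = {\<xi> \<in> Field \<kappa>. j \<xi>}"
  then have "\<xi> \<notin> Field \<kappa> \<Longrightarrow> i \<xi> = j \<xi>"
    by (simp add: cexp_def Field_card_of Func_def)
  moreover from eq have "\<xi> \<in> Field \<kappa> \<Longrightarrow> i \<xi> = j \<xi>" by blast
  ultimately show "i \<xi> = j \<xi>" by blast
qed

theorem lemma3p5:
  fixes \<kappa> :: "'a rel" and W :: "'a set set"
  assumes "regular_cardinal \<kappa>"
    and "ultrafilter_on (Field \<kappa>) W"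
    and "sigma_complete W"
    and "diamond_star_thin \<kappa> W"
  shows "non_galvin \<kappa> W"
proof -
  note reg = assms(1)
  have co: "Card_order \<kappa>" and inf: "infinite (Field \<kappa>)"
    using reg unfolding regular_cardinal_def by auto
  have wo: "Well_order \<kappa>" using co unfolding card_order_on_def by blast
  have W: "W \<subseteq> Pow (Field \<kappa>)" using assms(2) by (simp add: ultrafilter_on_def)
  obtain \<A> :: "'a \<Rightarrow> 'a set set" where \<A>:
    "(\<forall>\<alpha>\<in>Field \<kappa>. cardSuc |\<A> \<alpha>| <o \<kappa>) \<and>
     (\<forall>A. A \<subseteq> Field \<kappa> \<longrightarrow> {\<alpha> \<in> Field \<kappa>. A \<inter> underS \<kappa> \<alpha> \<in> \<A> \<alpha>} \<in> W) \<and>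
     \<not> almost_one_to_one \<kappa> W (\<lambda>\<alpha>. cardinality (\<A> \<alpha>))"
    using assms(4) unfolding diamond_star_thin_def by (rule exE)
  then have small: "\<And>\<alpha>. \<alpha> \<in> Field \<kappa> \<Longrightarrow> cardSuc |\<A> \<alpha>| <o \<kappa>"
    and guess: "\<And>A. A \<subseteq> Field \<kappa> \<Longrightarrow> {\<alpha> \<in> Field \<kappa>. A \<inter> underS \<kappa> \<alpha> \<in> \<A> \<alpha>} \<in> W"
    and thin: "\<not> almost_one_to_one \<kappa> W (\<lambda>\<alpha>. cardinality (\<A> \<alpha>))"
    by simp_all
  let ?S = "\<lambda>i :: 'a \<Rightarrow> bool. {\<xi> \<in> Field \<kappa>. i \<xi>}"
  let ?B = "\<lambda>i. {\<alpha> \<in> Field \<kappa>. ?S i \<inter> underS \<kappa> \<alpha> \<in> \<A> \<alpha>}"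
  let ?E = "Field (BNF_Cardinal_Arithmetic.ctwo ^c \<kappa>) :: ('a \<Rightarrow> bool) set"
  have "\<not> galvin_property \<kappa> W"
  proof
    assume "galvin_property \<kappa> W"
    then have "(\<forall>i\<in>?E. ?B i \<in> W) \<longrightarrow>
        (\<exists>I. I \<subseteq> ?E \<and> |I| =o \<kappa> \<and> (\<Inter>i\<in>I. ?B i) \<in> W)"
      unfolding galvin_property_def by (rule spec)
    moreover have "\<forall>i\<in>?E. ?B i \<in> W" by (intro ballI guess) simp
    ultimately have "\<exists>I. I \<subseteq> ?E \<and> |I| =o \<kappa> \<and> (\<Inter>i\<in>I. ?B i) \<in> W" by (rule mp)
    then obtain I where I: "I \<subseteq> ?E" "|I| =o \<kappa>" and B: "(\<Inter>i\<in>I. ?B i) \<in> W"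
      by (elim exE conjE)
    define B where "B = (\<Inter>i\<in>I. ?B i)"
    have BW: "B \<in> W" using B unfolding B_def .
    then have BF: "B \<subseteq> Field \<kappa>" using W by blast
    obtain x where x: "\<not> bounded_below \<kappa> {\<alpha> \<in> B. cardinality (\<A> \<alpha>) = x}"
      using thin BW unfolding almost_one_to_one_def by blast
    have xF: "{\<alpha> \<in> B. cardinality (\<A> \<alpha>) = x} \<subseteq> Field \<kappa>" using BF by blast
    \<comment> \<open>The empty set would be bounded, so the fibre over \<open>x\<close> has an
      element \<open>\<alpha>\<^sub>0\<close>; it represents the size class \<open>x\<close> by an
      actual cardinal \<lambda>, that of \<open>\<A> \<alpha>\<^sub>0\<close>.\<close>
    have "Field \<kappa> \<noteq> {}" using inf by auto
    then obtain \<alpha>\<^sub>0 where a0: "\<alpha>\<^sub>0 \<in> B" "cardinality (\<A> \<alpha>\<^sub>0) = x"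
      using x unfolding bounded_below_def by blast
    \<comment> \<open>An index set of size exactly the successor of \<lambda>: one too many for a
      set of size \<lambda>, yet by \<open>small\<close> still below \<kappa>, so that it embeds
      into \<open>I\<close> and its traces can be separated.\<close>
    let ?K = "Field (cardSuc |\<A> \<alpha>\<^sub>0| )"
    have coS: "Card_order (cardSuc |\<A> \<alpha>\<^sub>0| )" by (rule cardSuc_Card_order[OF card_of_Card_order])
    have K: "|?K| =o cardSuc |\<A> \<alpha>\<^sub>0|" by (rule card_of_Field_ordIso[OF coS])
    have K_less: "|?K| <o \<kappa>"
      using ordIso_ordLess_trans[OF K small] a0(1) BF by blast
    then have "|?K| \<le>o |I|"
      by (rule ordLess_imp_ordLeq[OF ordLess_ordIso_trans, OF _ ordIso_symmetric[OF I(2)]])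
    then obtain g where g: "inj_on g ?K" "g ` ?K \<subseteq> I"
      using card_of_ordLeq[of ?K I] by blast
    have "inj_on (?S \<circ> g) ?K"
      using g I(1) by (intro comp_inj_on) (auto intro: inj_on_subset[OF inj_on_Collect_Field_cexp])
    moreover have "(?S \<circ> g) ` ?K \<subseteq> Pow (Field \<kappa>)" by auto
    ultimately obtain \<beta> where \<beta>: "\<beta> \<in> Field \<kappa>"
      "\<And>\<alpha>. \<beta> \<in> underS \<kappa> \<alpha> \<Longrightarrow> inj_on (\<lambda>k. (?S \<circ> g) k \<inter> underS \<kappa> \<alpha>) ?K"
      using inj_on_traces[OF reg K_less] by blast
    \<comment> \<open>Unboundedness of the fibre gives an \<alpha> beyond the separating \<beta> at
      which the guessing family still has size \<lambda>.\<close>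
    obtain \<alpha> where \<alpha>: "\<alpha> \<in> B" "cardinality (\<A> \<alpha>) = x" "\<beta> \<in> underS \<kappa> \<alpha>"
      using not_bounded_below_obtain[OF wo xF x \<beta>(1)] by blast
    have "(\<lambda>k. (?S \<circ> g) k \<inter> underS \<kappa> \<alpha>) ` ?K \<subseteq> \<A> \<alpha>"
      using \<alpha>(1) g(2) unfolding B_def by auto
    with \<beta>(2)[OF \<alpha>(3)] have "|?K| \<le>o |\<A> \<alpha>|"
      using card_of_ordLeq by blast
    \<comment> \<open>Equal size classes become equipotence because each set belongs to its own
      class.\<close>
    moreover have "\<A> \<alpha> \<in> cardinality (\<A> \<alpha>)"
      unfolding cardinality_def by (simp add: card_of_refl)
    then have "\<A> \<alpha> \<in> cardinality (\<A> \<alpha>\<^sub>0)"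
      unfolding \<alpha>(2) a0(2) .
    then have "|\<A> \<alpha>| =o |\<A> \<alpha>\<^sub>0|" unfolding cardinality_def by simp
    ultimately have "|?K| \<le>o |\<A> \<alpha>\<^sub>0|" by (rule ordLeq_ordIso_trans)
    then have "cardSuc |\<A> \<alpha>\<^sub>0| \<le>o |\<A> \<alpha>\<^sub>0|"
      by (rule ordIso_ordLeq_trans[OF ordIso_symmetric[OF K]])
    moreover have "|\<A> \<alpha>\<^sub>0| <o cardSuc |\<A> \<alpha>\<^sub>0|" by (rule cardSuc_greater[OF card_of_Card_order])
    ultimately show False using not_ordLess_ordLeq by blast
  qed
  with not_almost_one_to_one_uniform[OF reg W thin] show ?thesis
    unfolding non_galvin_def by blast
qed

end
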